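(* Fix $d\ge1$ and let $S_N\subseteq\mathbb Z_N^d$ be nonempty sets ($N$ ranging over an unbounded set of moduli) with $|S_N|=N^{\alpha+o(1)}$, where $0<\alpha<d$. Suppose that for some $2<q<\infty$ one has $$\|E_{S_N}g\|_q\leq C\|g\|_{L^2(\mu_{S_N})}\qquad(\ast)$$ for all weights $g:S_N\to\mathbb C$ and all $N$, with $C$ independent of $N$. Set $\kappa_+=\overline\kappa(\{1_{S_N}\})$. (1) If $\kappa_+<\frac{\alpha}{2}$, then necessarily $$q\geq\frac{2(d-2\kappa_+)}{\alpha-2\kappa_+}.$$ (2) If $\kappa_+=\frac{\alpha}{2}$, no estimate of the form $(\ast)$ holds for finite $q$ (i.e. for any $2<q<\infty$ and any $C$ independent of $N$). (3) More generally, under $(\ast)$, at each modulus $N$ every nonzero function $f:\mathbb Z_N^d\to\mathbb C$ supported on $S_N$ must satisfy $$N^{\frac{d}{2}}|S_N|^{-\frac{1}{2}}\operatorname{FR}(f)^{-(1-\frac{2}{q})}\leq C.$$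
   Context: $\mathbb Z_N=\mathbb Z/N\mathbb Z$, $N\ge2$; all limits are taken within the given unbounded set of moduli. For $f:\mathbb Z_N^d\to\mathbb C$ the unitary Fourier transform is $\widehat f(\xi)=N^{-d/2}\sum_{x\in\mathbb Z_N^d}f(x)e^{-2\pi i x\cdot\xi/N}$. Unless a measure is displayed, norms use counting measure: $\|f\|_r=(\sum_x|f(x)|^r)^{1/r}$. $1_S$ is the indicator of $S$. For $f\neq0$, $\operatorname{FR}(f)=\|\widehat f\|_1/\|\widehat f\|_2$ and $\kappa_N(f)=\log\bigl(N^{d/2}/\operatorname{FR}(f)\bigr)/\log N$; $\overline\kappa(\{f_N\})=\limsup_{N\to\infty}\kappa_N(f_N)$. For nonempty $S\subseteq\mathbb Z_N^d$ and $g:S\to\mathbb C$, $$E_Sg(m)=\frac1{|S|}\sum_{x\in S}g(x)e^{\frac{2\pi i x\cdot m}{N}}\ (m\in\mathbb Z_N^d),\qquad \|g\|_{L^2(\mu_S)}=\left(\frac1{|S|}\sum_{x\in S}|g(x)|^2\right)^{\frac12},$$ and $\|E_Sg\|_q$ is taken with counting measure on $\mathbb Z_N^d$. $|S_N|=N^{\alpha+o(1)}$ means $\log|S_N|/\log N\to\alpha$. *)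

theory Defs
  imports "HOL-Analysis.Analysis"
begin

text \<open>A point of \<open>(\<int>/N\<int>)\<^sup>d\<close> is given by the least nonnegative representatives
  of its \<open>d\<close> coordinates. A complex function on \<open>(\<int>/N\<int>)\<^sup>d\<close> (or on a subset of it) is a
  total function of which only the values on that set are ever used.\<close>

definition ZN :: "nat \<Rightarrow> nat \<Rightarrow> (nat \<Rightarrow> int) set" where
  "ZN N d = ({..<d} \<rightarrow>\<^sub>E {0..<int N})"

definition dotp :: "nat \<Rightarrow> (nat \<Rightarrow> int) \<Rightarrow> (nat \<Rightarrow> int) \<Rightarrow> int" where
  "dotp d x y = (\<Sum>i<d. x i * y i)"

definition fourier :: "nat \<Rightarrow> nat \<Rightarrow> ((nat \<Rightarrow> int) \<Rightarrow> complex) \<Rightarrow> (nat \<Rightarrow> int) \<Rightarrow> complex" where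
  "fourier N d f \<xi> =
     of_real (real N powr (- real d / 2)) *
     (\<Sum>x\<in>ZN N d. f x * exp (- 2 * of_real pi * \<i> * of_int (dotp d x \<xi>) / of_nat N))"

definition lnorm :: "real \<Rightarrow> 'a set \<Rightarrow> ('a \<Rightarrow> complex) \<Rightarrow> real" where
  "lnorm r A f = (\<Sum>x\<in>A. cmod (f x) powr r) powr (1 / r)"

definition FR :: "nat \<Rightarrow> nat \<Rightarrow> ((nat \<Rightarrow> int) \<Rightarrow> complex) \<Rightarrow> real" where
  "FR N d f = lnorm 1 (ZN N d) (fourier N d f) / lnorm 2 (ZN N d) (fourier N d f)"

definition kappa :: "nat \<Rightarrow> nat \<Rightarrow> ((nat \<Rightarrow> int) \<Rightarrow> complex) \<Rightarrow> real" where
  "kappa N d f = ln (real N powr (real d / 2) / FR N d f) / ln (real N)"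

definition at_top_in :: "nat set \<Rightarrow> nat filter" where
  "at_top_in M = inf at_top (principal M)"

text \<open>The limit superior is taken in the extended reals; it is always finite, see
  \<open>ereal_kappa_bar\<close> below, so the conversion to a real number loses nothing.\<close>

definition kappa_bar :: "nat set \<Rightarrow> nat \<Rightarrow> (nat \<Rightarrow> (nat \<Rightarrow> int) \<Rightarrow> complex) \<Rightarrow> real" where
  "kappa_bar M d f = real_of_ereal (Limsup (at_top_in M) (\<lambda>N. ereal (kappa N d (f N))))"

definition extension ::
  "nat \<Rightarrow> nat \<Rightarrow> (nat \<Rightarrow> int) set \<Rightarrow> ((nat \<Rightarrow> int) \<Rightarrow> complex) \<Rightarrow> (nat \<Rightarrow> int) \<Rightarrow> complex" where
  "extension N d S g m =
     (\<Sum>x\<in>S. g x * exp (2 * of_real pi * \<i> * of_int (dotp d x m) / of_nat N)) / of_nat (card S)"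

definition L2_mu :: "'a set \<Rightarrow> ('a \<Rightarrow> complex) \<Rightarrow> real" where
  "L2_mu S g = sqrt ((\<Sum>x\<in>S. (cmod (g x))\<^sup>2) / real (card S))"

definition extension_estimate ::
  "nat set \<Rightarrow> nat \<Rightarrow> (nat \<Rightarrow> (nat \<Rightarrow> int) set) \<Rightarrow> real \<Rightarrow> real \<Rightarrow> bool" where
  "extension_estimate M d S q C \<longleftrightarrow>
     (\<forall>N\<in>M. \<forall>g. lnorm q (ZN N d) (extension N d (S N) g) \<le> C * L2_mu (S N) g)"


lemma finite_ZN: "finite (ZN N d)"
  unfolding ZN_def by (intro finite_PiE) auto

lemma card_ZN: "card (ZN N d) = N ^ d"
  unfolding ZN_def by (subst card_PiE) auto

lemma lnorm_1: "lnorm 1 A f = (\<Sum>x\<in>A. cmod (f x))"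
  unfolding lnorm_def by (simp add: sum_nonneg)

lemma lnorm_2: "lnorm 2 A f = L2_set (\<lambda>x. cmod (f x)) A"
  unfolding lnorm_def L2_set_def by (simp add: powr_half_sqrt sum_nonneg)

lemma kappa_bounds:
  assumes "N \<ge> 2"
  shows "0 \<le> kappa N d f" and "kappa N d f \<le> real d / 2"
proof -
  define F where "F = fourier N d f"
  define l1 l2 where "l1 = lnorm 1 (ZN N d) F" and "l2 = lnorm 2 (ZN N d) F"
  define R where "R = real N powr (real d / 2)"
  have FR: "FR N d f = l1 / l2"
    by (simp add: FR_def l1_def l2_def F_def)
  have lnN: "ln (real N) > 0"
    using assms by simp
  have R0: "R > 0"
    using assms by (simp add: R_def)
  have RR: "R = sqrt (real (card (ZN N d)))"
    using assms by (simp add: R_def card_ZN powr_half_sqrt_powr powr_realpow)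
  have a: "l2 \<le> l1"
    unfolding l1_def l2_def lnorm_1 lnorm_2 by (intro L2_set_le_sum) auto
  have b: "l1 \<le> R * l2"
  proof -
    have "(\<Sum>x\<in>ZN N d. \<bar>1\<bar> * \<bar>cmod (F x)\<bar>) \<le> L2_set (\<lambda>x. 1) (ZN N d) * L2_set (\<lambda>x. cmod (F x)) (ZN N d)"
      by (rule L2_set_mult_ineq)
    then show ?thesis
      unfolding l1_def l2_def lnorm_1 lnorm_2 RR by (simp add: L2_set_def)
  qed
  have l20: "l2 \<ge> 0"
    by (simp add: l2_def lnorm_def)
  have "0 \<le> kappa N d f \<and> kappa N d f \<le> real d / 2"
  proof (cases "l2 = 0")
    case True
    then show ?thesis by (simp add: kappa_def FR)
  next
    case False
    then have p: "l2 > 0" using l20 by simp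
    have f1: "l1 / l2 \<ge> 1" using a p by simp
    have f2: "l1 / l2 \<le> R" using b p by (simp add: field_simps)
    have "l1 / l2 > 0" using f1 by linarith
    then have g1: "R / (l1 / l2) \<ge> 1" using f2 by (simp only: le_divide_eq_1_pos)
    have g2: "R / (l1 / l2) \<le> R"
      using divide_left_mono[OF f1, of R] f1 R0 by simp
    have "ln (R / (l1 / l2)) \<le> ln R" using g1 g2 by (intro ln_mono) auto
    also have "\<dots> = real d / 2 * ln (real N)" using assms by (simp add: R_def ln_powr)
    finally have u: "ln (R / (l1 / l2)) \<le> real d / 2 * ln (real N)" .
    have l: "0 \<le> ln (R / (l1 / l2))" using g1 by (rule ln_ge_zero)
    have k: "kappa N d f = ln (R / (l1 / l2)) / ln (real N)"
      by (simp only: kappa_def FR R_def)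
    show ?thesis
      unfolding k using u l lnN by (simp only: pos_divide_le_eq) auto
  qed
  then show "0 \<le> kappa N d f" and "kappa N d f \<le> real d / 2" by auto
qed

lemma at_top_in_nontrivial: "infinite M \<Longrightarrow> at_top_in M \<noteq> bot"
  unfolding at_top_in_def trivial_limit_def eventually_inf_principal eventually_at_top_linorder
  by (metis infinite_nat_iff_unbounded_le)

lemma ereal_kappa_bar:
  assumes "infinite M" and "\<forall>N\<in>M. N \<ge> 2"
  shows "ereal (kappa_bar M d f) = Limsup (at_top_in M) (\<lambda>N. ereal (kappa N d (f N)))"
proof -
  let ?L = "Limsup (at_top_in M) (\<lambda>N. ereal (kappa N d (f N)))"
  have ev: "eventually (\<lambda>N. N \<in> M) (at_top_in M)"
    by (simp add: at_top_in_def eventually_inf_principal)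
  have "?L \<le> ereal (real d / 2)"
    by (rule Limsup_bounded, rule eventually_mono[OF ev]) (use assms kappa_bounds in auto)
  moreover have "ereal 0 \<le> Liminf (at_top_in M) (\<lambda>N. ereal (kappa N d (f N)))"
    by (rule Liminf_bounded, rule eventually_mono[OF ev]) (use assms kappa_bounds in auto)
  moreover have "Liminf (at_top_in M) (\<lambda>N. ereal (kappa N d (f N))) \<le> ?L"
    by (rule Liminf_le_Limsup) (rule at_top_in_nontrivial[OF assms(1)])
  ultimately have "ereal 0 \<le> ?L" "?L \<le> ereal (real d / 2)" by auto
  then have "\<bar>?L\<bar> \<noteq> \<infinity>" by (cases ?L) auto
  then show ?thesis
    unfolding kappa_bar_def by (rule ereal_real')
qed

end

theory Submission
  imports Defs "HOL-Real_Asymp.Real_Asymp"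
begin

text \<open>Up to normalization, \<open>extension\<close> of a weight supported on \<open>S\<close> is the Fourier transform, so with
  \<open>F = fourier f\<close> and Plancherel the estimate bounds \<open>lnorm q F / lnorm 2 F\<close> by \<open>C N\<^bsup>-d/2\<^esup> |S|\<^bsup>1/2\<^esup>\<close>. Log-convexity of the norms
  between 1, 2 and \<open>q\<close> bounds the same ratio from below by \<open>FR f\<close> to the power \<open>-(1 - 2/q)\<close>. For the
  indicator of \<open>S\<close>, dividing the logarithm of the resulting inequality by \<open>ln N\<close> and passing
  to the limit superior gives \<open>\<kappa> (q - 2) \<le> \<alpha> q / 2 - d\<close>.\<close>

section \<open>Additive characters modulo \<open>N\<close> and their orthogonality\<close>

text \<open>The kernels of \<open>extension\<close> and \<open>fourier\<close> are this character
  and its conjugate; writing it with \<open>cis\<close> reduces their algebra to arithmetic of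
  angles.\<close>

definition chi :: "nat \<Rightarrow> int \<Rightarrow> complex" where
  "chi N j = cis (2 * pi * of_int j / of_nat N)"

lemma exp_eq_chi: "exp (2 * of_real pi * \<i> * of_int j / of_nat N) = chi N j"
  by (simp add: chi_def cis_conv_exp mult_ac)

lemma exp_eq_cnj_chi: "exp (- 2 * of_real pi * \<i> * of_int j / of_nat N) = cnj (chi N j)"
  by (simp add: chi_def cis_cnj) (simp add: cis_conv_exp mult_ac)

lemma chi_0 [simp]: "chi N 0 = 1"
  by (simp add: chi_def)

lemma chi_add: "chi N (i + j) = chi N i * chi N j"
  by (simp add: chi_def cis_mult add_divide_distrib distrib_left)

lemma chi_diff: "chi N (i - j) = chi N i * cnj (chi N j)"
  by (simp add: chi_def cis_cnj cis_mult diff_divide_distrib right_diff_distrib)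

lemma chi_sum: "chi N (\<Sum>i\<in>A. f i) = (\<Prod>i\<in>A. chi N (f i))"
  by (induction A rule: infinite_finite_induct) (auto simp: chi_add)

lemma chi_power: "chi N (j * int k) = chi N j ^ k"
  by (simp add: chi_def Complex.DeMoivre mult_ac)

lemma chi_eq_1_iff:
  assumes "N > 0"
  shows "chi N j = 1 \<longleftrightarrow> int N dvd j"
proof
  assume "chi N j = 1"
  then have "cos (2 * pi * of_int j / of_nat N) = 1"
    by (simp add: chi_def complex_eq_iff)
  then obtain n :: int where "2 * pi * of_int j / of_nat N = of_int n * 2 * pi"
    by (auto simp: cos_one_2pi_int)
  then have "real_of_int j = of_int (int N * n)"
    using assms by (simp add: field_simps)
  then show "int N dvd j"
    by (metis dvd_triv_left of_int_eq_iff)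
next
  assume "int N dvd j"
  then obtain n where "j = int N * n" ..
  then show "chi N j = 1"
    using assms cos_int_2pin[of n] sin_int_2pin[of n]
    by (simp add: chi_def complex_eq_iff mult_ac)
qed

text \<open>A geometric sum whose ratio is an \<open>N\<close>-th root of unity. The range allowed
  for \<open>j\<close> is that of differences of least nonnegative representatives, and 0 is its
  only multiple of \<open>N\<close>.\<close>

lemma sum_chi:
  assumes "N > 0" "\<bar>j\<bar> < int N"
  shows "(\<Sum>k\<in>{0..<int N}. chi N (j * k)) = (if j = 0 then of_nat N else 0)"
proof (cases "j = 0")
  case False
  then have "\<not> int N dvd j"
    using assms zdvd_not_zless[of "\<bar>j\<bar>" "int N"] by auto
  then have ne: "chi N j \<noteq> 1"
    using assms by (simp add: chi_eq_1_iff)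
  have "(\<Sum>k\<in>{0..<int N}. chi N (j * k)) = (\<Sum>k<N. chi N j ^ k)"
    by (rule sum.reindex_bij_witness[of _ int nat]) (auto simp flip: chi_power)
  also have "\<dots> = (chi N (j * int N) - 1) / (chi N j - 1)"
    using ne by (simp add: geometric_sum chi_power)
  also have "chi N (j * int N) = 1"
    using assms by (simp add: chi_eq_1_iff)
  finally show ?thesis
    using False by simp
qed auto

text \<open>The character of a dot product factors over the coordinates, so the sum over the box is
  a product of \<open>d\<close> one-dimensional sums, and a single differing coordinate makes it
  vanish.\<close>

lemma sum_ZN_chi:
  assumes "N > 0" "x \<in> ZN N d" "y \<in> ZN N d"
  shows "(\<Sum>m\<in>ZN N d. cnj (chi N (dotp d x m)) * chi N (dotp d y m))
         = (if x = y then of_nat N ^ d else 0)"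
proof -
  have bd: "\<bar>y i - x i\<bar> < int N" if "i < d" for i
    using assms that unfolding ZN_def by (force dest: PiE_mem)
  \<comment> \<open>Members of \<open>ZN N d\<close> are extensional, so they agree outside the
    first \<open>d\<close> arguments.\<close>
  have eq: "x = y \<longleftrightarrow> (\<forall>i<d. y i - x i = 0)"
    using assms unfolding ZN_def by (auto intro: PiE_ext)
  have "(\<Sum>m\<in>ZN N d. cnj (chi N (dotp d x m)) * chi N (dotp d y m))
        = (\<Sum>m\<in>ZN N d. chi N (dotp d y m - dotp d x m))"
    by (simp add: chi_diff mult.commute)
  also have "\<dots> = (\<Sum>m\<in>ZN N d. \<Prod>i<d. chi N ((y i - x i) * m i))"
    by (simp add: dotp_def left_diff_distrib flip: chi_sum sum_subtractf)
  also have "\<dots> = (\<Prod>i<d. \<Sum>k\<in>{0..<int N}. chi N ((y i - x i) * k))"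
    unfolding ZN_def by (subst prod_sum_PiE) auto
  also have "\<dots> = (\<Prod>i<d. if y i - x i = 0 then of_nat N else 0)"
    using bd assms by (intro prod.cong) (auto simp: sum_chi)
  also have "\<dots> = (if x = y then of_nat N ^ d else 0)"
    unfolding eq by (auto intro!: prod_zero)
  finally show ?thesis .
qed

section \<open>Plancherel for the unitary transform\<close>

lemma fourier_eq:
  "fourier N d f \<xi> = of_real (real N powr (- real d / 2)) *
     (\<Sum>x\<in>ZN N d. f x * cnj (chi N (dotp d x \<xi>)))"
  unfolding fourier_def exp_eq_cnj_chi ..

lemma sum_norm_sq_fourier:
  assumes "N > 0"
  shows "(\<Sum>m\<in>ZN N d. (cmod (fourier N d f m))\<^sup>2) = (\<Sum>x\<in>ZN N d. (cmod (f x))\<^sup>2)"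
proof -
  define G where "G m = (\<Sum>x\<in>ZN N d. f x * cnj (chi N (dotp d x m)))" for m
  have "complex_of_real (\<Sum>m\<in>ZN N d. (cmod (G m))\<^sup>2) = (\<Sum>m\<in>ZN N d. G m * cnj (G m))"
    by (simp add: complex_norm_square del: of_real_power)
  also have "\<dots> = (\<Sum>m\<in>ZN N d. \<Sum>x\<in>ZN N d. \<Sum>y\<in>ZN N d.
      f x * cnj (f y) * (cnj (chi N (dotp d x m)) * chi N (dotp d y m)))"
    unfolding G_def cnj_sum sum_product by (intro sum.cong refl) (simp add: mult_ac)
  \<comment> \<open>Two exchanges bring the frequency sum innermost, where orthogonality leaves only
    the diagonal.\<close>
  also have "\<dots> = (\<Sum>x\<in>ZN N d. \<Sum>m\<in>ZN N d. \<Sum>y\<in>ZN N d.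
      f x * cnj (f y) * (cnj (chi N (dotp d x m)) * chi N (dotp d y m)))"
    by (rule sum.swap)
  also have "\<dots> = (\<Sum>x\<in>ZN N d. \<Sum>y\<in>ZN N d. \<Sum>m\<in>ZN N d.
      f x * cnj (f y) * (cnj (chi N (dotp d x m)) * chi N (dotp d y m)))"
    by (rule sum.cong[OF refl]) (rule sum.swap)
  also have "\<dots> = (\<Sum>x\<in>ZN N d. \<Sum>y\<in>ZN N d.
      if x = y then of_nat N ^ d * (f x * cnj (f y)) else 0)"
    using assms by (intro sum.cong refl) (simp add: sum_ZN_chi flip: sum_distrib_left)
  also have "\<dots> = (\<Sum>x\<in>ZN N d. of_nat N ^ d * (f x * cnj (f x)))"
    by (intro sum.cong refl) (simp add: finite_ZN)
  also have "\<dots> = complex_of_real (real N ^ d * (\<Sum>x\<in>ZN N d. (cmod (f x))\<^sup>2))"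
    by (simp add: sum_distrib_left complex_norm_square[symmetric])
  finally have G: "(\<Sum>m\<in>ZN N d. (cmod (G m))\<^sup>2) = real N ^ d * (\<Sum>x\<in>ZN N d. (cmod (f x))\<^sup>2)"
    by (simp only: of_real_eq_iff)
  \<comment> \<open>The squared unitary factor cancels the \<open>N ^ d\<close> produced by
    orthogonality.\<close>
  have "(real N powr (- real d / 2))\<^sup>2 = inverse (real N ^ d)"
  proof -
    have "(real N powr (- real d / 2))\<^sup>2 = real N powr (- real d)"
      unfolding power2_eq_square powr_add[symmetric] by simp
    then show ?thesis
      using assms by (simp add: powr_minus powr_realpow)
  qed
  moreover have "cmod (fourier N d f m) ^ 2 = (real N powr (- real d / 2))\<^sup>2 * (cmod (G m))\<^sup>2" for m
    by (simp add: fourier_eq G_def norm_mult power_mult_distrib)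
  ultimately show ?thesis
    using assms by (simp add: G flip: sum_distrib_left)
qed

section \<open>Hoelder's inequality and interpolation of norms\<close>

text \<open>After both sums are normalised to 1, weighted AM-GM holds term by term, and the right
  sides add up to \<open>s + t = 1\<close>.\<close>

lemma Hoelder_inequality_sum:
  fixes a b :: "'a \<Rightarrow> real"
  assumes "\<And>i. i \<in> A \<Longrightarrow> a i \<ge> 0" "\<And>i. i \<in> A \<Longrightarrow> b i \<ge> 0" "s > 0" "t > 0" "s + t = 1"
  shows "(\<Sum>i\<in>A. a i powr s * b i powr t) \<le> (\<Sum>i\<in>A. a i) powr s * (\<Sum>i\<in>A. b i) powr t"
proof (cases "finite A \<and> (\<Sum>i\<in>A. a i) \<noteq> 0 \<and> (\<Sum>i\<in>A. b i) \<noteq> 0")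
  case True
  define P Q where "P = (\<Sum>i\<in>A. a i)" and "Q = (\<Sum>i\<in>A. b i)"
  have P: "P > 0" and Q: "Q > 0"
    using True assms(1,2) by (auto simp: P_def Q_def less_le sum_nonneg)
  have "(\<Sum>i\<in>A. a i powr s * b i powr t) \<le> (\<Sum>i\<in>A. P powr s * Q powr t * (s * (a i / P) + t * (b i / Q)))"
  proof (rule sum_mono)
    fix i assume i: "i \<in> A"
    \<comment> \<open>If a factor vanishes, the left side is 0 because \<open>0 powr s = 0\<close>;
      otherwise this is Young's inequality.\<close>
    have "(a i / P) powr s * (b i / Q) powr t \<le> s * (a i / P) + t * (b i / Q)"
    proof (cases "a i = 0 \<or> b i = 0")
      case True
      then show ?thesis using assms i P Q by auto
    next
      case False
      then show ?thesis
        using assms i P Q by (intro Youngs_inequality_0) (auto simp: less_le)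
    qed
    then show "a i powr s * b i powr t \<le> P powr s * Q powr t * (s * (a i / P) + t * (b i / Q))"
      using P Q assms i by (simp add: powr_divide field_simps)
  qed
  also have "\<dots> = P powr s * Q powr t * (s * (\<Sum>i\<in>A. a i / P) + t * (\<Sum>i\<in>A. b i / Q))"
    by (simp only: sum.distrib flip: sum_distrib_left)
  also have "(\<Sum>i\<in>A. a i / P) = 1"
    using P by (simp add: P_def flip: sum_divide_distrib)
  also have "(\<Sum>i\<in>A. b i / Q) = 1"
    using Q by (simp add: Q_def flip: sum_divide_distrib)
  finally show ?thesis
    using assms by (simp add: P_def Q_def)
next
  case False
  \<comment> \<open>In each case both sides are 0, since sums over infinite sets are 0 and so are
    powers of 0.\<close>
  then consider "infinite A" | "\<And>i. i \<in> A \<Longrightarrow> a i = 0" | "\<And>i. i \<in> A \<Longrightarrow> b i = 0"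
    using assms(1,2) by (metis sum_nonneg_eq_0_iff)
  then show ?thesis
    by cases auto
qed

text \<open>Hoelder applied to the splitting of the squared modulus into a power of
  \<open>cmod (F i)\<close> and a power of \<open>cmod (F i) powr q\<close>. The form without
  quotients also covers vanishing norms.\<close>

lemma lnorm_interpolate_1_2:
  assumes "q > 2"
  shows "lnorm 2 A F powr (2 - 2 / q) \<le> lnorm 1 A F powr (1 - 2 / q) * lnorm q A F"
proof -
  \<comment> \<open>The solution of \<open>s + t = 1\<close> and \<open>s + q * t = 2\<close>. The
    outer power \<open>(q - 1) / q\<close> then turns \<open>t\<close> into \<open>1 / q\<close>,
    which makes the last factor exactly the \<open>q\<close>-norm.\<close>
  define s t where "s = (q - 2) / (q - 1)" and "t = 1 / (q - 1)"
  have st: "s > 0" "t > 0"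
    using assms by (auto simp: s_def t_def)
  have st': "s + t = 1" "s + q * t = 2"
    using assms by (simp_all add: s_def t_def divide_eq_eq flip: add_divide_distrib)
  have e: "s * ((q - 1) / q) = 1 - 2 / q" "t * ((q - 1) / q) = 1 / q"
    using assms by (auto simp: s_def t_def field_simps)
  have pw: "cmod (F i) powr s * (cmod (F i) powr q) powr t = cmod (F i) powr 2" for i
    using st' by (simp add: powr_powr flip: powr_add)
  have "lnorm 2 A F powr (2 - 2 / q) = (\<Sum>i\<in>A. cmod (F i) powr 2) powr ((q - 1) / q)"
  proof -
    have "1 / 2 * (2 - 2 / q) = (q - 1) / q"
      using assms by (simp add: field_simps)
    then show ?thesis
      by (simp only: lnorm_def powr_powr)
  qed
  also have "\<dots> \<le> ((\<Sum>i\<in>A. cmod (F i)) powr s * (\<Sum>i\<in>A. cmod (F i) powr q) powr t) powr ((q - 1) / q)"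
    unfolding pw[symmetric] using assms st st'
    by (intro powr_mono2 Hoelder_inequality_sum sum_nonneg) auto
  also have "\<dots> = lnorm 1 A F powr (1 - 2 / q) * lnorm q A F"
    by (subst powr_mult) (simp_all only: powr_powr e lnorm_1 lnorm_def[of q] powr_ge_zero)
  finally show ?thesis .
qed

section \<open>The extension operator in terms of the Fourier transform\<close>

lemma lnorm_cmult:
  assumes "c \<ge> 0" "q > 0"
  shows "lnorm q A (\<lambda>x. of_real c * F x) = c * lnorm q A F"
  using assms by (simp add: lnorm_def norm_mult powr_mult sum_nonneg powr_powr flip: sum_distrib_left)

lemma lnorm_cong_norm: "(\<And>x. x \<in> A \<Longrightarrow> cmod (F x) = cmod (G x)) \<Longrightarrow> lnorm q A F = lnorm q A G"
  by (simp add: lnorm_def)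

text \<open>Conjugating the weight turns the extension kernel into the Fourier kernel at the same
  frequency, so no reflection of the frequency variable is needed.\<close>

lemma lnorm_extension_cnj:
  assumes "N > 0" "S \<subseteq> ZN N d" "\<forall>x\<in>ZN N d - S. f x = 0" "q > 0"
  shows "lnorm q (ZN N d) (extension N d S (\<lambda>x. cnj (f x)))
         = real N powr (real d / 2) / real (card S) * lnorm q (ZN N d) (fourier N d f)"
proof -
  have "extension N d S (\<lambda>x. cnj (f x)) m
        = cnj (of_real (real N powr (real d / 2) / real (card S)) * fourier N d f m)" for m
  proof -
    have "(\<Sum>x\<in>S. f x * cnj (chi N (dotp d x m))) = (\<Sum>x\<in>ZN N d. f x * cnj (chi N (dotp d x m)))"
      using assms by (intro sum.mono_neutral_left) (auto simp: finite_ZN)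
    \<comment> \<open>Undoing the unitary normalisation is what puts \<open>N powr (d / 2)\<close>
      into the constant.\<close>
    moreover have "complex_of_real (real N powr (real d / 2)) * of_real (real N powr (- real d / 2)) = 1"
      using assms by (simp flip: of_real_mult powr_add)
    ultimately have "of_real (real N powr (real d / 2)) * fourier N d f m
        = (\<Sum>x\<in>S. f x * cnj (chi N (dotp d x m)))"
      unfolding fourier_eq by (simp flip: mult.assoc)
    then have "of_real (real N powr (real d / 2) / real (card S)) * fourier N d f m
        = (\<Sum>x\<in>S. f x * cnj (chi N (dotp d x m))) / of_nat (card S)"
      by simp
    then have "cnj (of_real (real N powr (real d / 2) / real (card S)) * fourier N d f m)
        = (\<Sum>x\<in>S. cnj (f x) * chi N (dotp d x m)) / of_nat (card S)"
      by (simp only: cnj_sum complex_cnj_divide complex_cnj_mult complex_cnj_cnj complex_cnj_of_nat)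
    then show ?thesis
      unfolding extension_def exp_eq_chi by (rule sym)
  qed
  then have "lnorm q (ZN N d) (extension N d S (\<lambda>x. cnj (f x)))
      = lnorm q (ZN N d) (\<lambda>m. of_real (real N powr (real d / 2) / real (card S)) * fourier N d f m)"
    by (intro lnorm_cong_norm) (simp only: complex_mod_cnj)
  then show ?thesis
    using assms by (subst (asm) lnorm_cmult) auto
qed

text \<open>Conjugation keeps moduli and Plancherel moves the 2-norm to the frequency side, so both
  sides of the extension estimate become norms of the same \<open>fourier N d f\<close>.\<close>

lemma L2_mu_cnj:
  assumes "N > 0" "S \<subseteq> ZN N d" "\<forall>x\<in>ZN N d - S. f x = 0"
  shows "L2_mu S (\<lambda>x. cnj (f x)) = lnorm 2 (ZN N d) (fourier N d f) / sqrt (real (card S))"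
proof -
  have "(\<Sum>x\<in>S. (cmod (f x))\<^sup>2) = (\<Sum>x\<in>ZN N d. (cmod (f x))\<^sup>2)"
    using assms by (intro sum.mono_neutral_left) (auto simp: finite_ZN)
  then show ?thesis
    using assms by (simp add: L2_mu_def lnorm_2 L2_set_def sum_norm_sq_fourier real_sqrt_divide)
qed

section \<open>The lower bound on the constant at one modulus\<close>

lemma lnorm_2_fourier_pos:
  assumes "N > 0" "x \<in> ZN N d" "f x \<noteq> 0"
  shows "lnorm 2 (ZN N d) (fourier N d f) > 0"
  using assms by (auto simp: lnorm_2 L2_set_def sum_norm_sq_fourier finite_ZN intro!: sum_pos2[of _ x])

lemma FR_pos:
  assumes "N > 0" "x \<in> ZN N d" "f x \<noteq> 0"
  shows "FR N d f > 0"
proof -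
  have "lnorm 2 (ZN N d) (fourier N d f) \<le> lnorm 1 (ZN N d) (fourier N d f)"
    unfolding lnorm_1 lnorm_2 by (intro L2_set_le_sum) auto
  then show ?thesis
    using lnorm_2_fourier_pos[of N x d f] assms by (simp add: FR_def)
qed

text \<open>Kept to one modulus and an arbitrary \<open>f\<close>, this yields the third claim
  directly and the first two through the indicator of \<open>S\<close>.\<close>

lemma FR_bound:
  assumes "N > 0" "S \<subseteq> ZN N d" "S \<noteq> {}" "q > 2"
    and est: "\<And>g. lnorm q (ZN N d) (extension N d S g) \<le> C * L2_mu S g"
    and f: "x \<in> ZN N d" "f x \<noteq> 0" "\<forall>x\<in>ZN N d - S. f x = 0"
  shows "real N powr (real d / 2) * real (card S) powr (- 1 / 2) * FR N d f powr (- (1 - 2 / q)) \<le> C"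
proof -
  define F where "F = fourier N d f"
  define l where "l r = lnorm r (ZN N d) F" for r
  define n R where "n = real (card S)" and "R = real N powr (real d / 2)"
  have n: "n > 0"
    using assms finite_subset[OF assms(2) finite_ZN] by (simp add: n_def card_gt_0_iff)
  have l2: "l 2 > 0"
    using lnorm_2_fourier_pos[of N x d f] assms by (simp add: l_def F_def)
  have FR: "FR N d f = l 1 / l 2" "FR N d f > 0"
    using FR_pos[of N x d f] assms by (simp_all add: FR_def l_def F_def)
  then have l1: "l 1 > 0"
    using l2 by (simp add: zero_less_divide_iff)
  \<comment> \<open>The exponent is split so that dividing by \<open>l 2\<close> leaves the ratio
    \<open>l 1 / l 2\<close> to the power \<open>1 - 2 / q\<close>.\<close>
  have "l 2 * l 2 powr (1 - 2 / q) = l 2 powr (2 - 2 / q)"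
    using powr_add[of "l 2" 1 "1 - 2 / q"] l2 by simp
  also have "\<dots> \<le> l 1 powr (1 - 2 / q) * l q"
    unfolding l_def using \<open>q > 2\<close> by (rule lnorm_interpolate_1_2)
  finally have "FR N d f powr (- (1 - 2 / q)) \<le> l q / l 2"
    using l1 l2 unfolding FR(1) powr_minus by (simp add: powr_divide field_simps)
  then have "R * n powr (- 1 / 2) * FR N d f powr (- (1 - 2 / q)) \<le> R * n powr (- 1 / 2) * (l q / l 2)"
    by (intro mult_left_mono) (auto simp: R_def)
  \<comment> \<open>Regrouped so that \<open>R / n * l q\<close> is the norm of the extension of the
    conjugated weight.\<close>
  also have "\<dots> = (R / n * l q) * sqrt n / l 2"
    using n l2 by (simp add: powr_minus powr_half_sqrt field_simps flip: real_sqrt_mult)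
  also have "R / n * l q \<le> C * (l 2 / sqrt n)"
    using est[of "\<lambda>x. cnj (f x)"] assms
      lnorm_extension_cnj[of N S d f q] L2_mu_cnj[of N S d f]
    by (simp add: R_def n_def l_def F_def)
  then have "(R / n * l q) * sqrt n / l 2 \<le> C * (l 2 / sqrt n) * sqrt n / l 2"
    using n l2 by (intro divide_right_mono mult_right_mono) auto
  also have "\<dots> = C"
    using n l2 by simp
  finally show ?thesis
    by (simp add: R_def n_def)
qed

section \<open>Passage to the limit for indicators\<close>

text \<open>In logarithms to base \<open>N\<close>, the size of \<open>S N\<close> tends to \<alpha>
  and the constant \<open>C\<close> disappears. No division by
  \<open>\<alpha> - 2 * \<kappa>\<close> occurs in the conclusion, so it serves the critical case
  too.\<close>

lemma kappa_indicator_bound: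
  assumes "infinite M" "\<forall>N\<in>M. N \<ge> 2"
    and S: "\<forall>N\<in>M. S N \<subseteq> ZN N d \<and> S N \<noteq> {}"
    and lim: "((\<lambda>N. ln (real (card (S N))) / ln (real N)) \<longlongrightarrow> \<alpha>) (at_top_in M)"
    and q: "q > 2" and est: "extension_estimate M d S q C"
  shows "kappa_bar M d (\<lambda>N. indicator (S N)) * (q - 2) \<le> \<alpha> * q / 2 - real d"
proof -
  define \<theta> where "\<theta> = 1 - 2 / q"
  have \<theta>: "\<theta> > 0"
    using q by (simp add: \<theta>_def)
  \<comment> \<open>The logarithm of \<open>FR_bound\<close> divided by \<open>ln N\<close> and
    solved for \<open>kappa\<close>; the term \<open>d / q\<close> is
    \<open>d / 2 * (1 - \<theta>)\<close>.\<close>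
  define h where "h N = (ln C / ln (real N) + ln (real (card (S N))) / ln (real N) / 2 - real d / q) / \<theta>" for N
  have ev: "eventually (\<lambda>N. N \<in> M) (at_top_in M)"
    by (simp add: at_top_in_def eventually_inf_principal)
  have le: "kappa N d (indicator (S N)) \<le> h N" if N: "N \<in> M" for N
  proof -
    let ?f = "indicator (S N) :: (nat \<Rightarrow> int) \<Rightarrow> complex"
    define k where "k = kappa N d ?f"
    have N2: "N \<ge> 2" and lnN: "ln (real N) > 0"
      using assms N by auto
    obtain x where x: "x \<in> S N" "x \<in> ZN N d"
      using S N by blast
    have card: "real (card (S N)) > 0"
      using S N finite_subset[OF _ finite_ZN] by (auto simp: card_gt_0_iff)
    have FRp: "FR N d ?f > 0"
      using N2 x by (intro FR_pos[of N x]) auto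
    have B: "real N powr (real d / 2) * real (card (S N)) powr (- 1 / 2) * FR N d ?f powr (- \<theta>) \<le> C"
      unfolding \<theta>_def using N2 S N q est x
      by (intro FR_bound[of N "S N" d q C x]) (auto simp: extension_estimate_def)
    have lnFR: "ln (FR N d ?f) = (real d / 2 - k) * ln (real N)"
      using lnN FRp N2 by (simp add: k_def kappa_def ln_div ln_powr field_simps)
    \<comment> \<open>The left side of \<open>B\<close> is positive, hence so is \<open>C\<close>,
      and the logarithm preserves the inequality.\<close>
    have "ln (real N powr (real d / 2) * real (card (S N)) powr (- 1 / 2) * FR N d ?f powr (- \<theta>)) \<le> ln C"
      using B card FRp N2 by (intro ln_mono) auto
    then have "real d / 2 * ln (real N) - ln (real (card (S N))) / 2 - \<theta> * ((real d / 2 - k) * ln (real N)) \<le> ln C"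
      using card FRp N2 by (simp add: ln_mult ln_powr lnFR)
    then have "(real d / 2 * (1 - \<theta>) + \<theta> * k) * ln (real N) \<le> ln C + ln (real (card (S N))) / 2"
      by (simp add: field_simps)
    then have "real d / 2 * (1 - \<theta>) + \<theta> * k \<le> (ln C + ln (real (card (S N))) / 2) / ln (real N)"
      using lnN by (simp add: pos_le_divide_eq)
    also have "real d / 2 * (1 - \<theta>) = real d / q"
      by (simp add: \<theta>_def)
    finally show ?thesis
      using \<theta> by (simp add: h_def k_def pos_le_divide_eq add_divide_distrib algebra_simps)
  qed
  have "((\<lambda>N. ln C / ln (real N)) \<longlongrightarrow> 0) at_top"
    by real_asymp
  then have "((\<lambda>N. ln C / ln (real N)) \<longlongrightarrow> 0) (at_top_in M)"
    unfolding at_top_in_def by (rule tendsto_mono[rotated]) simp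
  then have "(h \<longlongrightarrow> (0 + \<alpha> / 2 - real d / q) / \<theta>) (at_top_in M)"
    unfolding h_def using lim \<theta> by (intro tendsto_intros) auto
  then have "((\<lambda>N. ereal (h N)) \<longlongrightarrow> ereal ((\<alpha> / 2 - real d / q) / \<theta>)) (at_top_in M)"
    by simp
  then have L: "Limsup (at_top_in M) (\<lambda>N. ereal (h N)) = ereal ((\<alpha> / 2 - real d / q) / \<theta>)"
    by (rule lim_imp_Limsup[OF at_top_in_nontrivial[OF assms(1)]])
  \<comment> \<open>The values of \<open>kappa\<close> need not converge; it suffices that their
    majorant \<open>h\<close> does.\<close>
  have "ereal (kappa_bar M d (\<lambda>N. indicator (S N))) \<le> Limsup (at_top_in M) (\<lambda>N. ereal (h N))"
    unfolding ereal_kappa_bar[OF assms(1,2)]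
    by (rule Limsup_mono, rule eventually_mono[OF ev]) (simp add: le)
  then have "kappa_bar M d (\<lambda>N. indicator (S N)) * \<theta> \<le> \<alpha> / 2 - real d / q"
    using \<theta> unfolding L by (simp add: pos_le_divide_eq)
  then have "kappa_bar M d (\<lambda>N. indicator (S N)) * \<theta> * q \<le> (\<alpha> / 2 - real d / q) * q"
    using q by (intro mult_right_mono) auto
  moreover have "\<theta> * q = q - 2"
    using q by (simp add: \<theta>_def field_simps)
  ultimately show ?thesis
    using q by (simp add: left_diff_distrib mult.assoc)
qed

theorem proposition8p6:
  fixes d :: nat and M :: "nat set" and S :: "nat \<Rightarrow> (nat \<Rightarrow> int) set"
    and \<alpha> \<kappa> :: real
  assumes "d \<ge> 1"
    and "infinite M" and "\<forall>N\<in>M. N \<ge> 2"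
    and "\<forall>N\<in>M. S N \<subseteq> ZN N d \<and> S N \<noteq> {}"
    and "((\<lambda>N. ln (real (card (S N))) / ln (real N)) \<longlongrightarrow> \<alpha>) (at_top_in M)"
    and "0 < \<alpha>" and "\<alpha> < real d"
    and "\<kappa> = kappa_bar M d (\<lambda>N. indicator (S N))"
  shows "(\<forall>q C. 2 < q \<and> extension_estimate M d S q C \<longrightarrow>
            \<kappa> < \<alpha> / 2 \<longrightarrow> q \<ge> 2 * (real d - 2 * \<kappa>) / (\<alpha> - 2 * \<kappa>)) \<and>
         (\<kappa> = \<alpha> / 2 \<longrightarrow> \<not> (\<exists>q C. 2 < q \<and> extension_estimate M d S q C)) \<and>
         (\<forall>q C. 2 < q \<and> extension_estimate M d S q C \<longrightarrow>
            (\<forall>N\<in>M. \<forall>f :: (nat \<Rightarrow> int) \<Rightarrow> complex.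
               (\<exists>x\<in>ZN N d. f x \<noteq> 0) \<and> (\<forall>x\<in>ZN N d - S N. f x = 0) \<longrightarrow>
               real N powr (real d / 2) * real (card (S N)) powr (- 1 / 2) *
                 FR N d f powr (- (1 - 2 / q)) \<le> C))"
proof (intro conjI allI impI notI ballI)
  note bound = kappa_indicator_bound[OF assms(2-5), folded assms(8)]
  {
    fix q C assume "2 < q \<and> extension_estimate M d S q C" and "\<kappa> < \<alpha> / 2"
    \<comment> \<open>Doubling and collecting \<open>q\<close> gives
      \<open>2 * (d - 2 * \<kappa>) \<le> q * (\<alpha> - 2 * \<kappa>)\<close>, where the last
      factor is positive.\<close>
    then show "q \<ge> 2 * (real d - 2 * \<kappa>) / (\<alpha> - 2 * \<kappa>)"
      using bound[of q C] by (simp add: field_simps)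
  next
    assume k: "\<kappa> = \<alpha> / 2" and "\<exists>q C. 2 < q \<and> extension_estimate M d S q C"
    then obtain q C where q: "2 < q" "extension_estimate M d S q C"
      by blast
    \<comment> \<open>At the critical value the terms in \<open>q\<close> cancel, so the
      contradiction is the same for every exponent.\<close>
    then have "real d \<le> \<alpha>"
      using bound[of q C] k by (simp add: field_simps)
    then show False
      using assms(7) by simp
  next
    fix q C N and f :: "(nat \<Rightarrow> int) \<Rightarrow> complex"
    assume *: "2 < q \<and> extension_estimate M d S q C" and N: "N \<in> M"
      and f: "(\<exists>x\<in>ZN N d. f x \<noteq> 0) \<and> (\<forall>x\<in>ZN N d - S N. f x = 0)"
    then obtain x where "x \<in> ZN N d" "f x \<noteq> 0"
      by blast
    moreover have "N > 0"
      using assms(3) N by fastforce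
    ultimately show "real N powr (real d / 2) * real (card (S N)) powr (- 1 / 2) *
        FR N d f powr (- (1 - 2 / q)) \<le> C"
      using * N f assms(4) by (intro FR_bound[of N "S N" d q C x]) (auto simp: extension_estimate_def)
  }
qed

end
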